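(* Let $(\mathcal{A},\cdot,\mathfrak{B})$ be a quadratic Zinbiel superalgebra over a field $\mathbb{K}$, let $\mathcal{N}=\mathcal{N}_{\bar 1}=\mathbb{K}d$ be the one-dimensional $\mathbb{Z}_2$-graded vector space with even part zero, with dual $\mathcal{N}^*=\mathbb{K}d^*$, and let $(\delta,D,\mathfrak{a}_0)$ be an admissible triple of $\mathcal{A}$ such that $\delta(\mathcal{A})\subseteq{\rm Ann}(\mathcal{A})$, $\delta(\mathcal{A}^2)=\{0\}$, $\delta\circ D=D\circ\delta=0$, $\mathfrak{a}_0\in{\rm Ann}(\mathcal{A})\cap\mathcal{A}_{\bar 0}$ and $\mathfrak{B}(\mathfrak{a}_0,\mathfrak{a}_0)=0$, where $D$ is an odd endomorphism of $\mathcal{A}$ satisfying $\mathfrak{B}(\delta(x),y)=(-1)^{|x|+|y|}\mathfrak{B}(x,D(y))$ for all homogeneous $x,y\in\mathcal{A}$. Then the $\mathbb{Z}_2$-graded vector space $\overline{\mathcal{A}}=\mathcal{N}^*\oplus\mathcal{A}\oplus\mathcal{N}$ endowed with the product $$d\odot d=\mathfrak{a}_0,\quad d\odot x=\delta(x)-\mathfrak{B}(x,\mathfrak{a}_0)d^*,\quad x\odot y=xy-\mathfrak{B}(\delta(x),y)d^*,\quad x\odot d=D(x)+\mathfrak{B}(x,\mathfrak{a}_0)d^*,$$ for all $x,y\in\mathcal{A}$ (all products involving $d^*$ being zero), is a symmetric Zinbiel superalgebra. Moreover, the even bilinear form $\overline{\mathfrak{B}}:\overline{\mathcal{A}}\times\overline{\mathcal{A}}\to\mathbb{K}$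 defined by $\overline{\mathfrak{B}}|_{\mathcal{A}\times\mathcal{A}}=\mathfrak{B}$, $\overline{\mathfrak{B}}(d^*,d)=-\overline{\mathfrak{B}}(d,d^* )=1$ (all other pairings of the summands being zero) is an associative (i.e. invariant) scalar product on $\overline{\mathcal{A}}$.
   Context: A superalgebra is a finite-dimensional $\mathbb{Z}_2$-graded vector space $\mathcal{A}=\mathcal{A}_{\bar 0}\oplus\mathcal{A}_{\bar 1}$ over $\mathbb{K}$ with a bilinear product satisfying $\mathcal{A}_i\mathcal{A}_j\subset\mathcal{A}_{i+j}$; $|x|$ is the degree of a homogeneous $x$. Left Zinbiel: $(xy)z=x(yz)+(-1)^{|y||z|}x(zy)$; right Zinbiel: $x(yz)=(xy)z+(-1)^{|x||y|}(yx)z$ (for homogeneous elements); symmetric Zinbiel: both. ${\rm Ann}(\mathcal{A})=\{a: a\mathcal{A}=\mathcal{A}a=0\}$, and $\mathcal{A}^2$ is the span of all products. A quadratic Zinbiel superalgebra is a left (or right) Zinbiel superalgebra with an invariant (associative) scalar product, i.e. a non-degenerate bilinear form $\mathfrak{B}$ that is supersymmetric ($\mathfrak{B}(x,y)=(-1)^{|x||y|}\mathfrak{B}(y,x)$), invariant ($\mathfrak{B}(xy,z)=\mathfrak{B}(x,yz)$) and even ($\mathfrak{B}(\mathcal{A}_{\bar 0},\mathcal{A}_{\bar 1})=\mathfrak{B}(\mathcal{A}_{\bar 1},\mathcal{A}_{\bar 0})=0$). Such a superalgebra is automatically symmetric Zinbiel. Admissible triple: let $\mathcal{A}$ be a symmetric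 Zinbiel superalgebra, $\delta,D$ homogeneous endomorphisms of $\mathcal{A}$ of degree $|d|$, and $\mathfrak{a}_0\in{\rm Ann}(\mathcal{A})\cap\mathcal{A}_{\bar 0}$. $(\delta,D,\mathfrak{a}_0)$ is admissible if for all homogeneous $x,y\in\mathcal{A}$: $\delta(xy)=(-1)^{|d||x|}x\delta(y)=\delta(x)y+(-1)^{|d||x|}D(x)y=-(-1)^{|y|(|x|+|d|)}D(y)x$; $\delta(x)y=(-1)^{|x||y|}\delta(y)x=-(-1)^{|d|(|x|+|y|)}xD(y)$; $D(xy)=(-1)^{|d||y|}D(x)y$; $\delta^2(x)=(-1)^{|d|}\delta^2(x)=-D^2(x)=(1+(-1)^{|d|})\mathfrak{a}_0x$; $\delta\circ D(x)=-(-1)^{|d|}D\circ\delta(x)=(-1)^{|d||x|}x\mathfrak{a}_0=-(-1)^{|d|(|x|+|d|)}\mathfrak{a}_0x$; $\delta(\mathfrak{a}_0)=D(\mathfrak{a}_0)=0$. Here $|d|=\bar 1$, so $\delta$ and $D$ are odd; $d$ and $d^*$ are odd. *)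

theory Defs
  imports Complex_Main "HOL-Library.Z2" "HOL-Library.Product_Plus"
begin

(* The sign (-1)^i for a degree i in Z_2, where Z_2 is the type bit. *)
definition parity_sign :: "bit \<Rightarrow> 'k::ring_1" where
  "parity_sign i = (if i = 0 then 1 else - 1)"

definition bilinear_map ::
  "('k::field \<Rightarrow> 'a::ab_group_add \<Rightarrow> 'a) \<Rightarrow> ('k \<Rightarrow> 'c::ab_group_add \<Rightarrow> 'c) \<Rightarrow> ('a \<Rightarrow> 'a \<Rightarrow> 'c) \<Rightarrow> bool"
where
  "bilinear_map s t f \<longleftrightarrow>
     (\<forall>x. Vector_Spaces.linear s t (\<lambda>y. f x y)) \<and> (\<forall>y. Vector_Spaces.linear s t (\<lambda>x. f x y))"

(* The underlying vector space is the whole type 'a; G i is its homogeneous component of degree i.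
   As 0 is homogeneous of both degrees, identities in |x|, |y|, ... are stated for all i, j, ...
   with x in G i, y in G j, ... *)
locale superalgebra = vector_space scale
  for scale :: "'k::field \<Rightarrow> 'a::ab_group_add \<Rightarrow> 'a" (infixr "*s" 75) +
  fixes G :: "bit \<Rightarrow> 'a set"
    and mul :: "'a \<Rightarrow> 'a \<Rightarrow> 'a" (infixl "\<cdot>" 70)
  assumes finite_dim: "\<exists>Basis. finite_dimensional_vector_space scale Basis"
    and subspace_G: "subspace (G i)"
    and G_sum: "\<exists>x0\<in>G 0. \<exists>x1\<in>G 1. x = x0 + x1"
    and G_inter: "G 0 \<inter> G 1 = {0}"
    and bilinear_mul: "bilinear_map scale scale mul"
    and graded_mul: "x \<in> G i \<Longrightarrow> y \<in> G j \<Longrightarrow> x \<cdot> y \<in> G (i + j)"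

locale left_zinbiel_superalgebra = superalgebra +
  assumes left_zinbiel: "x \<in> G i \<Longrightarrow> y \<in> G j \<Longrightarrow> z \<in> G k \<Longrightarrow>
    (x \<cdot> y) \<cdot> z = x \<cdot> (y \<cdot> z) + parity_sign (j * k) *s (x \<cdot> (z \<cdot> y))"

locale right_zinbiel_superalgebra = superalgebra +
  assumes right_zinbiel: "x \<in> G i \<Longrightarrow> y \<in> G j \<Longrightarrow> z \<in> G k \<Longrightarrow>
    x \<cdot> (y \<cdot> z) = (x \<cdot> y) \<cdot> z + parity_sign (i * j) *s ((y \<cdot> x) \<cdot> z)"

locale symmetric_zinbiel_superalgebra = left_zinbiel_superalgebra + right_zinbiel_superalgebra

definition annihilator :: "('a::zero \<Rightarrow> 'a \<Rightarrow> 'a) \<Rightarrow> 'a set" where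
  "annihilator mul = {a. \<forall>x. mul a x = 0 \<and> mul x a = 0}"

definition product_square ::
  "('k::field \<Rightarrow> 'a::ab_group_add \<Rightarrow> 'a) \<Rightarrow> ('a \<Rightarrow> 'a \<Rightarrow> 'a) \<Rightarrow> 'a set"
where
  "product_square scale mul = module.span scale {mul x y | x y. True}"

locale invariant_scalar_product = superalgebra scale G mul
  for scale :: "'k::field \<Rightarrow> 'a::ab_group_add \<Rightarrow> 'a" (infixr "*s" 75)
    and G :: "bit \<Rightarrow> 'a set"
    and mul :: "'a \<Rightarrow> 'a \<Rightarrow> 'a" (infixl "\<cdot>" 70) +
  fixes B :: "'a \<Rightarrow> 'a \<Rightarrow> 'k"
  assumes bilinear_B: "bilinear_map scale (*) B"
    and nondegenerate_left: "(\<forall>y. B x y = 0) \<Longrightarrow> x = 0"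
    and nondegenerate_right: "(\<forall>x. B x y = 0) \<Longrightarrow> y = 0"
    and supersymmetric: "x \<in> G i \<Longrightarrow> y \<in> G j \<Longrightarrow> B x y = parity_sign (i * j) * B y x"
    and invariant: "B (x \<cdot> y) z = B x (y \<cdot> z)"
    and even_form: "x \<in> G i \<Longrightarrow> y \<in> G j \<Longrightarrow> i \<noteq> j \<Longrightarrow> B x y = 0"

definition quadratic_zinbiel_superalgebra ::
  "('k::field \<Rightarrow> 'a::ab_group_add \<Rightarrow> 'a) \<Rightarrow> (bit \<Rightarrow> 'a set) \<Rightarrow> ('a \<Rightarrow> 'a \<Rightarrow> 'a) \<Rightarrow> ('a \<Rightarrow> 'a \<Rightarrow> 'k) \<Rightarrow> bool"
where
  "quadratic_zinbiel_superalgebra scale G mul B \<longleftrightarrow>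
     (left_zinbiel_superalgebra scale G mul \<or> right_zinbiel_superalgebra scale G mul) \<and>
     invariant_scalar_product scale G mul B"

(* The degree of the two endomorphisms is p. *)
locale admissible_triple = symmetric_zinbiel_superalgebra scale G mul
  for scale :: "'k::field \<Rightarrow> 'a::ab_group_add \<Rightarrow> 'a" (infixr "*s" 75)
    and G :: "bit \<Rightarrow> 'a set"
    and mul :: "'a \<Rightarrow> 'a \<Rightarrow> 'a" (infixl "\<cdot>" 70) +
  fixes p :: bit
    and \<delta> D :: "'a \<Rightarrow> 'a"
    and a0 :: 'a
  assumes linear_\<delta>: "Vector_Spaces.linear scale scale \<delta>"
    and linear_D: "Vector_Spaces.linear scale scale D"
    and degree_\<delta>: "x \<in> G i \<Longrightarrow> \<delta> x \<in> G (i + p)"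
    and degree_D: "x \<in> G i \<Longrightarrow> D x \<in> G (i + p)"
    and a0_in: "a0 \<in> annihilator mul \<inter> G 0"
    and \<delta>_mul:
      "x \<in> G i \<Longrightarrow> y \<in> G j \<Longrightarrow> \<delta> (x \<cdot> y) = parity_sign (p * i) *s (x \<cdot> \<delta> y)"
      "x \<in> G i \<Longrightarrow> y \<in> G j \<Longrightarrow> \<delta> (x \<cdot> y) = \<delta> x \<cdot> y + parity_sign (p * i) *s (D x \<cdot> y)"
      "x \<in> G i \<Longrightarrow> y \<in> G j \<Longrightarrow> \<delta> (x \<cdot> y) = - (parity_sign (j * (i + p)) *s (D y \<cdot> x))"
    and mul_\<delta>:
      "x \<in> G i \<Longrightarrow> y \<in> G j \<Longrightarrow> \<delta> x \<cdot> y = parity_sign (i * j) *s (\<delta> y \<cdot> x)"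
      "x \<in> G i \<Longrightarrow> y \<in> G j \<Longrightarrow> \<delta> x \<cdot> y = - (parity_sign (p * (i + j)) *s (x \<cdot> D y))"
    and D_mul: "x \<in> G i \<Longrightarrow> y \<in> G j \<Longrightarrow> D (x \<cdot> y) = parity_sign (p * j) *s (D x \<cdot> y)"
    and \<delta>_\<delta>:
      "x \<in> G i \<Longrightarrow> \<delta> (\<delta> x) = parity_sign p *s \<delta> (\<delta> x)"
      "x \<in> G i \<Longrightarrow> \<delta> (\<delta> x) = - D (D x)"
      "x \<in> G i \<Longrightarrow> \<delta> (\<delta> x) = (1 + parity_sign p) *s (a0 \<cdot> x)"
    and \<delta>_D:
      "x \<in> G i \<Longrightarrow> \<delta> (D x) = - (parity_sign p *s D (\<delta> x))"
      "x \<in> G i \<Longrightarrow> \<delta> (D x) = parity_sign (p * i) *s (x \<cdot> a0)"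
      "x \<in> G i \<Longrightarrow> \<delta> (D x) = - (parity_sign (p * (i + p)) *s (a0 \<cdot> x))"
    and \<delta>_a0: "\<delta> a0 = 0"
    and D_a0: "D a0 = 0"

(* The space N^* + A + N with N = K d odd of dimension one: the triple (s, x, t) stands for
   s d^* + x + t d. *)

abbreviation ext_d :: "'k::field \<times> 'a::ab_group_add \<times> 'k" where
  "ext_d \<equiv> (0, 0, 1)"

abbreviation ext_dual :: "'k::field \<times> 'a::ab_group_add \<times> 'k" where
  "ext_dual \<equiv> (1, 0, 0)"

abbreviation ext_in :: "'a::ab_group_add \<Rightarrow> 'k::field \<times> 'a \<times> 'k" where
  "ext_in x \<equiv> (0, x, 0)"

fun ext_scale ::
  "('k::field \<Rightarrow> 'a::ab_group_add \<Rightarrow> 'a) \<Rightarrow> 'k \<Rightarrow> 'k \<times> 'a \<times> 'k \<Rightarrow> 'k \<times> 'a \<times> 'k"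
where
  "ext_scale scale c (s, x, t) = (c * s, scale c x, c * t)"

definition ext_grading :: "(bit \<Rightarrow> 'a::ab_group_add set) \<Rightarrow> bit \<Rightarrow> ('k::field \<times> 'a \<times> 'k) set" where
  "ext_grading G i = (if i = 0 then {0} \<times> G 0 \<times> {0} else UNIV \<times> G 1 \<times> UNIV)"

(* The bilinear product determined by its values on d^*, d and A; see ext_mul_values below. *)
fun ext_mul ::
  "('k::field \<Rightarrow> 'a::ab_group_add \<Rightarrow> 'a) \<Rightarrow> ('a \<Rightarrow> 'a \<Rightarrow> 'a) \<Rightarrow> ('a \<Rightarrow> 'a \<Rightarrow> 'k) \<Rightarrow>
    ('a \<Rightarrow> 'a) \<Rightarrow> ('a \<Rightarrow> 'a) \<Rightarrow> 'a \<Rightarrow> 'k \<times> 'a \<times> 'k \<Rightarrow> 'k \<times> 'a \<times> 'k \<Rightarrow> 'k \<times> 'a \<times> 'k"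
where
  "ext_mul scale mul B \<delta> D a0 (s, x, t) (s', y, t') =
     (- B (\<delta> x) y - t * B y a0 + t' * B x a0,
      mul x y + scale t (\<delta> y) + scale t' (D x) + scale (t * t') a0,
      0)"

fun ext_form ::
  "('a::ab_group_add \<Rightarrow> 'a \<Rightarrow> 'k::field) \<Rightarrow> 'k \<times> 'a \<times> 'k \<Rightarrow> 'k \<times> 'a \<times> 'k \<Rightarrow> 'k"
where
  "ext_form B (s, x, t) (s', y, t') = B x y + s * t' - t * s'"

lemma bilinear_map_zero:
  assumes "bilinear_map s t f"
  shows "f x 0 = 0" "f 0 y = 0"
  using assms unfolding bilinear_map_def
  by (metis module_hom.zero module_hom_iff_linear)+

lemma bilinear_map_add:
  assumes "bilinear_map s t f"
  shows "f x (y + y') = f x y + f x y'" "f (x + x') y = f x y + f x' y"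
  using assms unfolding bilinear_map_def
  by (metis module_hom.add module_hom_iff_linear)+

lemma bilinear_map_scale:
  assumes "bilinear_map s t f"
  shows "f x (s c y) = t c (f x y)" "f (s c x) y = t c (f x y)"
  using assms unfolding bilinear_map_def
  by (metis module_hom.scale module_hom_iff_linear)+

lemma ext_mul_values:
  assumes "admissible_triple scale G mul p \<delta> D a0" and "bilinear_map scale (*) B"
  defines "m \<equiv> ext_mul scale mul B \<delta> D a0"
  shows "m ext_d ext_d = ext_in a0"
    and "m ext_d (ext_in x) = ext_in (\<delta> x) - ext_scale scale (B x a0) ext_dual"
    and "m (ext_in x) (ext_in y) = ext_in (mul x y) - ext_scale scale (B (\<delta> x) y) ext_dual"
    and "m (ext_in x) ext_d = ext_in (D x) + ext_scale scale (B x a0) ext_dual"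
    and "m ext_dual u = 0" and "m u ext_dual = 0"
    and "bilinear_map (ext_scale scale) (ext_scale scale) m"
proof -
  interpret admissible_triple scale G mul p \<delta> D a0 by fact
  have d0: "\<delta> 0 = 0" "D 0 = 0"
    using linear_\<delta> linear_D by (auto dest!: module_hom.zero simp: module_hom_iff_linear[symmetric])
  note z = bilinear_map_zero[OF assms(2)] bilinear_map_zero[OF bilinear_mul] d0
  show "m ext_d ext_d = ext_in a0"
    and "m ext_d (ext_in x) = ext_in (\<delta> x) - ext_scale scale (B x a0) ext_dual"
    and "m (ext_in x) (ext_in y) = ext_in (mul x y) - ext_scale scale (B (\<delta> x) y) ext_dual"
    and "m (ext_in x) ext_d = ext_in (D x) + ext_scale scale (B x a0) ext_dual"
    by (simp_all add: m_def z)
  show "m ext_dual u = 0" and "m u ext_dual = 0"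
    by (cases u, simp add: m_def z zero_prod_def)+
  interpret E: vector_space "ext_scale scale"
    by unfold_locales
      (auto simp: scale_right_distrib scale_left_distrib distrib_left distrib_right)
  note lin = module_hom.add[OF linear_\<delta>[folded module_hom_iff_linear]]
    module_hom.add[OF linear_D[folded module_hom_iff_linear]]
    module_hom.scale[OF linear_\<delta>[folded module_hom_iff_linear]]
    module_hom.scale[OF linear_D[folded module_hom_iff_linear]]
    bilinear_map_add[OF assms(2)] bilinear_map_add[OF bilinear_mul]
    bilinear_map_scale[OF assms(2)] bilinear_map_scale[OF bilinear_mul]
  show "bilinear_map (ext_scale scale) (ext_scale scale) m"
    unfolding bilinear_map_def linear_iff_module_hom
    by (auto intro!: module_hom.intro module_hom_axioms.intro E.module_axioms
      simp: m_def lin scale_right_distrib scale_left_distrib algebra_simps)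
qed

lemma ext_form_values:
  assumes "bilinear_map scale (*) B"
  shows "ext_form B (ext_in x) (ext_in y) = B x y"
    and "ext_form B ext_dual ext_d = 1" and "ext_form B ext_d ext_dual = - 1"
    and "ext_form B ext_dual ext_dual = 0" and "ext_form B ext_d ext_d = 0"
    and "ext_form B (ext_in x) ext_d = 0" and "ext_form B ext_d (ext_in x) = 0"
    and "ext_form B (ext_in x) ext_dual = 0" and "ext_form B ext_dual (ext_in x) = 0"
  by (auto simp: bilinear_map_zero[OF assms])

(* Admissible triples live on symmetric Zinbiel superalgebras; for a quadratic one this is no
   additional hypothesis. *)
lemma quadratic_imp_symmetric:
  fixes scale (infixr "*s" 75) and mul (infixl "\<cdot>" 70)
  assumes "quadratic_zinbiel_superalgebra scale G mul B"
  shows "symmetric_zinbiel_superalgebra scale G mul"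
proof -
  interpret invariant_scalar_product scale G mul B
    using assms by (simp add: quadratic_zinbiel_superalgebra_def)
  have eqI: "u = v" if "\<And>w. B w u = B w v" for u v
  proof -
    have "B w (u - v) = 0" for w
      using bilinear_map_add(1)[OF bilinear_B, of w "u - v" v] that[of w] by simp
    then show ?thesis using nondegenerate_right[of "u - v"] by auto
  qed
  have eqI': "u = v" if "\<And>w. B u w = B v w" for u v
  proof -
    have "B (u - v) w = 0" for w
      using bilinear_map_add(2)[OF bilinear_B, of "u - v" v w] that[of w] by simp
    then show ?thesis using nondegenerate_left[of "u - v"] by auto
  qed
  note lin = bilinear_map_add[OF bilinear_mul] bilinear_map_scale[OF bilinear_mul]
    bilinear_map_add[OF bilinear_B] bilinear_map_scale[OF bilinear_B]
  have decomp: "\<exists>w0\<in>G 0. \<exists>w1\<in>G 1. w = w0 + w1" for w by (rule G_sum)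
  show ?thesis
  proof (cases "left_zinbiel_superalgebra scale G mul")
    case True
    then interpret left_zinbiel_superalgebra scale G mul .
    show ?thesis
    proof unfold_locales
      fix x y z i j k
      assume *: "x \<in> G i" "y \<in> G j" "z \<in> G k"
      have h: "B w (x \<cdot> (y \<cdot> z)) = B w ((x \<cdot> y) \<cdot> z + parity_sign (i * j) *s ((y \<cdot> x) \<cdot> z))"
        if "w \<in> G l" for w l
      proof -
        have "B w (x \<cdot> (y \<cdot> z)) = B ((w \<cdot> x) \<cdot> y) z"
          by (simp add: invariant)
        also have "(w \<cdot> x) \<cdot> y = w \<cdot> (x \<cdot> y) + parity_sign (i * j) *s (w \<cdot> (y \<cdot> x))"
          using left_zinbiel[OF that *(1,2)] .
        finally show ?thesis
          by (simp add: lin invariant)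
      qed
      show "x \<cdot> (y \<cdot> z) = (x \<cdot> y) \<cdot> z + parity_sign (i * j) *s ((y \<cdot> x) \<cdot> z)"
      proof (rule eqI)
        fix w
        obtain w0 w1 where w: "w0 \<in> G 0" "w1 \<in> G 1" "w = w0 + w1" using decomp by blast
        show "B w (x \<cdot> (y \<cdot> z)) = B w ((x \<cdot> y) \<cdot> z + parity_sign (i * j) *s ((y \<cdot> x) \<cdot> z))"
          using h[OF w(1)] h[OF w(2)] unfolding w(3) bilinear_map_add(2)[OF bilinear_B] by simp
      qed
    qed
  next
    case False
    then interpret right_zinbiel_superalgebra scale G mul
      using assms by (simp add: quadratic_zinbiel_superalgebra_def)
    show ?thesis
    proof unfold_locales
      fix x y z i j k
      assume *: "x \<in> G i" "y \<in> G j" "z \<in> G k"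
      have h: "B ((x \<cdot> y) \<cdot> z) w = B (x \<cdot> (y \<cdot> z) + parity_sign (j * k) *s (x \<cdot> (z \<cdot> y))) w"
        if "w \<in> G l" for w l
      proof -
        have "B ((x \<cdot> y) \<cdot> z) w = B x (y \<cdot> (z \<cdot> w))"
          by (simp add: invariant)
        also have "y \<cdot> (z \<cdot> w) = (y \<cdot> z) \<cdot> w + parity_sign (j * k) *s ((z \<cdot> y) \<cdot> w)"
          using right_zinbiel[OF *(2,3) that] .
        finally show ?thesis
          by (simp add: lin invariant)
      qed
      show "(x \<cdot> y) \<cdot> z = x \<cdot> (y \<cdot> z) + parity_sign (j * k) *s (x \<cdot> (z \<cdot> y))"
      proof (rule eqI')
        fix w
        obtain w0 w1 where w: "w0 \<in> G 0" "w1 \<in> G 1" "w = w0 + w1" using decomp by blast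
        show "B ((x \<cdot> y) \<cdot> z) w = B (x \<cdot> (y \<cdot> z) + parity_sign (j * k) *s (x \<cdot> (z \<cdot> y))) w"
          using h[OF w(1)] h[OF w(2)] unfolding w(3) bilinear_map_add(1)[OF bilinear_B] by simp
      qed
    qed
  qed
qed

end

theory Submission
  imports Defs
begin

(* The hypotheses force \<delta> x, D x and a0 to annihilate all products in the algebra, and the
   d^*-coefficients of all triple products vanish. Hence every triple product in the extension is
   the corresponding triple product of the components in the algebra, and both Zinbiel identities
   are inherited. Invariance of the extended form rests on D being, up to sign, the adjoint of
   \<delta>. *)

section \<open>The extension as a finite-dimensional vector space\<close>

lemma vector_space_ext_scale:
  assumes "vector_space scale"
  shows "vector_space (ext_scale scale)"
proof -
  interpret vector_space scale by fact
  show ?thesis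
    by unfold_locales
      (auto simp: scale_right_distrib scale_left_distrib distrib_left distrib_right)
qed

text \<open>A basis of the algebra together with d and d^* gives a finite spanning set. A maximal
  independent subset of it is a basis, which avoids a direct proof of independence.\<close>

lemma finite_dimensional_ext_scale:
  fixes scale :: "'k::field \<Rightarrow> 'a::ab_group_add \<Rightarrow> 'a"
  assumes "finite_dimensional_vector_space scale Basis"
  shows "\<exists>Basis'. finite_dimensional_vector_space (ext_scale scale) Basis'"
proof -
  interpret finite_dimensional_vector_space scale Basis by fact
  interpret E: vector_space "ext_scale scale"
    by (rule vector_space_ext_scale) unfold_locales
  define S :: "('k \<times> 'a \<times> 'k) set" where "S = {ext_d, ext_dual} \<union> ext_in ` Basis"
  have in_span: "ext_in x \<in> E.span S" for x
  proof -
    have "x \<in> span Basis" by (simp add: span_Basis)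
    then show ?thesis
    proof (induction rule: span_induct_alt)
      case base
      then show ?case using E.span_zero[of S] by (simp add: zero_prod_def)
    next
      case (step c b y)
      have "ext_in b \<in> E.span S" using step by (intro E.span_base) (simp add: S_def)
      from E.span_add[OF E.span_scale[OF this, of c] step(2)] show ?case by simp
    qed
  qed
  have S_spans: "u \<in> E.span S" for u
  proof -
    obtain s x t where u: "u = (s, x, t)" by (cases u)
    have "ext_d \<in> E.span S" "ext_dual \<in> E.span S" by (auto intro!: E.span_base simp: S_def)
    then have "ext_scale scale s ext_dual + (ext_in x + ext_scale scale t ext_d) \<in> E.span S"
      by (intro E.span_add E.span_scale in_span)
    then show ?thesis by (simp add: u)
  qed
  obtain C where C: "C \<subseteq> S" "E.independent C" "S \<subseteq> E.span C"
    using E.maximal_independent_subset by blast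
  have "E.span C = UNIV"
    using S_spans E.span_minimal[OF C(3)] by auto
  moreover have "finite C"
    using C(1) finite_Basis by (auto simp: S_def intro: finite_subset)
  ultimately show ?thesis
    using C(2) by (intro exI[of _ C]) (unfold_locales, auto)
qed

section \<open>Vanishing rules and adjointness in the algebra\<close>

text \<open>The set-level hypotheses appear here elementwise, so that they can act as rewrite rules.
  Only \<open>adjoint_homogeneous\<close> stays graded, because its sign depends on the
  degrees.\<close>

locale odd_double_extension =
  admissible_triple scale G mul 1 \<delta> D a0 + invariant_scalar_product scale G mul B
  for scale :: "'k::field \<Rightarrow> 'a::ab_group_add \<Rightarrow> 'a" (infixr "*s" 75)
    and G :: "bit \<Rightarrow> 'a set"
    and mul :: "'a \<Rightarrow> 'a \<Rightarrow> 'a" (infixl "\<cdot>" 70)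
    and \<delta> D :: "'a \<Rightarrow> 'a"
    and a0 :: 'a
    and B :: "'a \<Rightarrow> 'a \<Rightarrow> 'k" +
  assumes \<delta>_annihilates: "\<delta> x \<in> annihilator mul"
    and \<delta>_product: "\<delta> (x \<cdot> y) = 0"
    and \<delta>_comp_D: "\<delta> (D x) = 0"
    and D_comp_\<delta>: "D (\<delta> x) = 0"
    and a0_isotropic: "B a0 a0 = 0"
    and adjoint_homogeneous:
      "x \<in> G i \<Longrightarrow> y \<in> G j \<Longrightarrow> B (\<delta> x) y = parity_sign (i + j) * B x (D y)"
begin

abbreviation ext_prod (infixl "\<odot>" 70) where
  "ext_prod \<equiv> ext_mul scale mul B \<delta> D a0"

lemma \<delta>_add: "\<delta> (x + y) = \<delta> x + \<delta> y" and D_add: "D (x + y) = D x + D y"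
  and \<delta>_scale: "\<delta> (c *s x) = c *s \<delta> x" and D_scale: "D (c *s x) = c *s D x"
  using linear_\<delta> linear_D
  by (auto simp: module_hom_iff_linear[symmetric] dest: module_hom.add module_hom.scale)

lemmas mul_lin = bilinear_map_zero[OF bilinear_mul] bilinear_map_add[OF bilinear_mul]
  bilinear_map_scale[OF bilinear_mul]

lemmas B_lin = bilinear_map_zero[OF bilinear_B] bilinear_map_add[OF bilinear_B]
  bilinear_map_scale[OF bilinear_B]

text \<open>Transfers additive statements from homogeneous elements to all elements: once its sign
  has disappeared, a graded axiom becomes an identity without degrees.\<close>

lemma homogeneous_induct:
  assumes "\<And>i x. x \<in> G i \<Longrightarrow> P x" and "\<And>x y. P x \<Longrightarrow> P y \<Longrightarrow> P (x + y)"
  shows "P x"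
  using G_sum[of x] assms by blast

lemma homogeneous_induct2:
  assumes "\<And>i j x y. x \<in> G i \<Longrightarrow> y \<in> G j \<Longrightarrow> P x y"
    and "\<And>x x' y. P x y \<Longrightarrow> P x' y \<Longrightarrow> P (x + x') y"
    and "\<And>x y y'. P x y \<Longrightarrow> P x y' \<Longrightarrow> P x (y + y')"
  shows "P x y"
  using G_sum[of x] G_sum[of y] assms by metis

lemma mul_annihilated:
  "\<delta> x \<cdot> y = 0" "x \<cdot> \<delta> y = 0" "a0 \<cdot> x = 0" "x \<cdot> a0 = 0"
  using \<delta>_annihilates a0_in by (auto simp: annihilator_def)

text \<open>In the second form of \<open>\<delta>_mul\<close> both
  \<open>\<delta> (x \<cdot> y)\<close> and \<open>\<delta> x \<cdot> y\<close> vanish, which leaves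
  this product up to sign.\<close>

lemma D_mul_zero: "D x \<cdot> y = 0"
proof -
  have *: "D x \<cdot> y = 0" if "x \<in> G i" "y \<in> G j" for i j x y
    using \<delta>_mul(2)[OF that] \<delta>_product[of x y] mul_annihilated
    by (simp add: parity_sign_def split: if_splits)
  show ?thesis
    by (induction x y rule: homogeneous_induct2) (auto simp: * D_add mul_lin)
qed

text \<open>By the second form of \<open>mul_\<delta>\<close> this product equals
  \<open>\<delta> x \<cdot> y\<close> up to sign, and \<open>\<delta> x\<close> is in the
  annihilator.\<close>

lemma mul_D_zero: "x \<cdot> D y = 0"
proof -
  have *: "x \<cdot> D y = 0" if "x \<in> G i" "y \<in> G j" for i j x y
    using mul_\<delta>(2)[OF that] mul_annihilated
    by (simp add: parity_sign_def split: if_splits)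
  show ?thesis
    by (induction x y rule: homogeneous_induct2) (auto simp: * D_add mul_lin)
qed

lemma D_product: "D (x \<cdot> y) = 0"
proof -
  have *: "D (x \<cdot> y) = 0" if "x \<in> G i" "y \<in> G j" for i j x y
    using D_mul[OF that] D_mul_zero by simp
  show ?thesis
    by (induction x y rule: homogeneous_induct2) (auto simp: * D_add mul_lin)
qed

text \<open>The third form of \<open>\<delta>_\<delta>\<close> makes the square a multiple of
  \<open>a0 \<cdot> x\<close>, and \<open>a0\<close> is in the annihilator.\<close>

lemma \<delta>_square: "\<delta> (\<delta> x) = 0"
  by (induction x rule: homogeneous_induct) (auto simp: \<delta>_add \<delta>_\<delta>(3) mul_annihilated)

lemma D_square: "D (D x) = 0"
proof (induction x rule: homogeneous_induct)
  case (1 i x)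
  then show ?case
    using \<delta>_\<delta>(2) \<delta>_square[of x] by fastforce
qed (simp add: D_add)

(* Both sides vanish when x and y have equal degree, since D and \<delta> are odd and B is even; this
   removes the sign. *)
lemma B_\<delta>_left: "B (\<delta> x) y = - B x (D y)"
proof -
  have *: "B (\<delta> x) y = - B x (D y)" if xy: "x \<in> G i" "y \<in> G j" for i j x y
  proof (cases "i = j")
    case True
    then have "B x (D y) = 0"
      using even_form[OF xy(1) degree_D[OF xy(2)]] by (cases j) auto
    then show ?thesis using adjoint_homogeneous[OF xy] by simp
  next
    case False
    then have "parity_sign (i + j) = (- 1 :: 'k)"
      by (cases i; cases j) (auto simp: parity_sign_def)
    then show ?thesis using adjoint_homogeneous[OF xy] by simp
  qed
  show ?thesis
    by (induction x y rule: homogeneous_induct2) (auto simp: * \<delta>_add D_add B_lin)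
qed

text \<open>For equal degrees both sides vanish because the form is even. For different degrees
  supersymmetry is applied twice; exactly one of the two signs is -1, and it cancels the minus sign
  of \<open>B_\<delta>_left\<close>.\<close>

lemma B_D_left: "B (D x) y = B x (\<delta> y)"
proof -
  have *: "B (D x) y = B x (\<delta> y)" if xy: "x \<in> G i" "y \<in> G j" for i j x y
  proof (cases "i = j")
    case True
    then show ?thesis
      using even_form[OF xy(1) degree_\<delta>[OF xy(2)]] even_form[OF degree_D[OF xy(1)] xy(2)]
      by (cases j) auto
  next
    case False
    have "B (D x) y = parity_sign ((i + 1) * j) * B y (D x)"
      using supersymmetric[OF degree_D[OF xy(1)] xy(2)] .
    also have "B y (D x) = - B (\<delta> y) x"
      by (simp add: B_\<delta>_left)
    also have "B (\<delta> y) x = parity_sign ((j + 1) * i) * B x (\<delta> y)"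
      using supersymmetric[OF degree_\<delta>[OF xy(2)] xy(1)] .
    finally show ?thesis
      using False by (cases i; cases j) (auto simp: parity_sign_def)
  qed
  show ?thesis
    by (induction x y rule: homogeneous_induct2) (auto simp: * \<delta>_add D_add B_lin)
qed

lemma B_a0_commute: "B x a0 = B a0 x"
proof (induction x rule: homogeneous_induct)
  case (1 i x)
  then show ?case
    using supersymmetric[OF 1, of a0 0] a0_in by (simp add: parity_sign_def)
qed (simp add: B_lin)

lemma a0_homogeneous: "a0 \<in> G 0"
  using a0_in by simp

section \<open>Triple products, grading and the Zinbiel identities\<close>

text \<open>No product has a d-component, and its component in the algebra is
  \<open>x \<cdot> y\<close> plus multiples of \<open>\<delta> y\<close>, \<open>D x\<close> and
  \<open>a0\<close>, all killed by the second multiplication. In the d^*-coefficient, adjointness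
  moves \<open>\<delta>\<close> and \<open>D\<close> across \<open>B\<close> onto elements that they
  annihilate; \<open>B a0 a0 = 0\<close> removes the last term.\<close>

lemma ext_triple_products:
  "((s, x, t) \<odot> (s', y, t')) \<odot> (s'', z, t'') = ext_in ((x \<cdot> y) \<cdot> z)"
  "(s, x, t) \<odot> ((s', y, t') \<odot> (s'', z, t'')) = ext_in (x \<cdot> (y \<cdot> z))"
proof -
  \<comment> \<open>Invariance turns this into \<open>B x (y \<cdot> a0)\<close>, where
    \<open>a0\<close> annihilates \<open>y\<close>.\<close>
  have "B (x \<cdot> y) a0 = 0"
    by (simp add: invariant mul_annihilated B_lin)
  then show "((s, x, t) \<odot> (s', y, t')) \<odot> (s'', z, t'') = ext_in ((x \<cdot> y) \<cdot> z)"
    by (simp add: mul_lin B_lin \<delta>_add D_add \<delta>_scale D_scale mul_annihilated D_mul_zero D_product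
        \<delta>_product \<delta>_square D_square \<delta>_comp_D D_comp_\<delta> \<delta>_a0 D_a0 B_\<delta>_left B_D_left
        a0_isotropic)
  have "B (y \<cdot> z) a0 = 0"
    by (simp add: invariant mul_annihilated B_lin)
  then show "(s, x, t) \<odot> ((s', y, t') \<odot> (s'', z, t'')) = ext_in (x \<cdot> (y \<cdot> z))"
    by (simp add: mul_lin B_lin \<delta>_add D_add \<delta>_scale D_scale mul_annihilated mul_D_zero D_product
        \<delta>_product \<delta>_square D_square \<delta>_comp_D D_comp_\<delta> \<delta>_a0 D_a0 B_\<delta>_left B_D_left
        a0_isotropic)
qed

lemma ext_grading_component: "(s, x, t) \<in> ext_grading G i \<Longrightarrow> x \<in> G i"
  by (cases i) (auto simp: ext_grading_def)

lemma superalgebra_ext: "superalgebra (ext_scale scale) (ext_grading G) ext_prod"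
proof -
  interpret E: vector_space "ext_scale scale"
    by (rule vector_space_ext_scale) unfold_locales
  have zero_G: "0 \<in> G i" for i
    using subspace_0[OF subspace_G] .
  show ?thesis
  proof unfold_locales
    show "\<exists>Basis. finite_dimensional_vector_space (ext_scale scale) Basis"
      using finite_dim finite_dimensional_ext_scale by blast
    show "E.subspace (ext_grading G i)" for i
      using zero_G subspace_add[OF subspace_G] subspace_scale[OF subspace_G]
      by (auto simp: E.subspace_def ext_grading_def zero_prod_def)
    show "\<exists>u0\<in>ext_grading G 0. \<exists>u1\<in>ext_grading G 1. u = u0 + u1" for u :: "'k \<times> 'a \<times> 'k"
    proof -
      obtain s x t where u: "u = (s, x, t)" by (cases u)
      obtain x0 x1 where "x0 \<in> G 0" "x1 \<in> G 1" "x = x0 + x1"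
        using G_sum by blast
      then show ?thesis
        \<comment> \<open>Both d and d^* are odd, so their coefficients go entirely to the odd
          summand.\<close>
        by (intro bexI[of _ "(0, x0, 0)"] bexI[of _ "(s, x1, t)"]) (auto simp: u ext_grading_def)
    qed
    show "ext_grading G 0 \<inter> ext_grading G 1 = {0 :: 'k \<times> 'a \<times> 'k}"
      using G_inter by (auto simp: ext_grading_def zero_prod_def)
    show "bilinear_map (ext_scale scale) (ext_scale scale) ext_prod"
      by (rule ext_mul_values(7)[OF _ bilinear_B]) unfold_locales
  next
    fix u v :: "'k \<times> 'a \<times> 'k" and i j
    assume u: "u \<in> ext_grading G i" and v: "v \<in> ext_grading G j"
    obtain s x t s' y t' where uv: "u = (s, x, t)" "v = (s', y, t')"
      by (cases u; cases v)
    have x: "x \<in> G i" and y: "y \<in> G j"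
      using u v by (auto simp: uv dest: ext_grading_component)
    note deg = graded_mul[OF x y] degree_\<delta>[OF x] degree_D[OF x] degree_\<delta>[OF y] degree_D[OF y]
      a0_homogeneous
    \<comment> \<open>When \<open>i + j\<close> is even the d^*-coefficient must be zero; evenness
      of \<open>B\<close> makes each of its terms vanish.\<close>
    note form = even_form[OF degree_\<delta>[OF x] y] even_form[OF x a0_homogeneous]
      even_form[OF y a0_homogeneous]
    show "u \<odot> v \<in> ext_grading G (i + j)"
      using u v deg form
      by (cases i; cases j)
        (auto simp: uv ext_grading_def B_lin intro!: subspace_add[OF subspace_G]
          subspace_scale[OF subspace_G])
  qed
qed

lemma symmetric_zinbiel_ext:
  "symmetric_zinbiel_superalgebra (ext_scale scale) (ext_grading G) ext_prod"
proof -
  interpret E: superalgebra "ext_scale scale" "ext_grading G" ext_prod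
    by (rule superalgebra_ext)
  show ?thesis
  proof unfold_locales
    fix u v w :: "'k \<times> 'a \<times> 'k" and i j k
    assume u: "u \<in> ext_grading G i" and v: "v \<in> ext_grading G j" and w: "w \<in> ext_grading G k"
    obtain s x t s' y t' s'' z t''
      where uvw: "u = (s, x, t)" "v = (s', y, t')" "w = (s'', z, t'')"
      by (cases u; cases v; cases w)
    have xyz: "x \<in> G i" "y \<in> G j" "z \<in> G k"
      using u v w by (auto simp: uvw dest: ext_grading_component)
    show "(u \<odot> v) \<odot> w = u \<odot> (v \<odot> w) + ext_scale scale (parity_sign (j * k)) (u \<odot> (w \<odot> v))"
      unfolding uvw ext_triple_products left_zinbiel[OF xyz] by simp
    show "u \<odot> (v \<odot> w) = (u \<odot> v) \<odot> w + ext_scale scale (parity_sign (i * j)) ((v \<odot> u) \<odot> w)"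
      unfolding uvw ext_triple_products right_zinbiel[OF xyz] by simp
  qed
qed

section \<open>The extended scalar product\<close>

lemma invariant_scalar_product_ext:
  "invariant_scalar_product (ext_scale scale) (ext_grading G) ext_prod (ext_form B)"
proof -
  interpret E: superalgebra "ext_scale scale" "ext_grading G" ext_prod
    by (rule superalgebra_ext)
  have K: "module ((*) :: 'k \<Rightarrow> 'k \<Rightarrow> 'k)"
    by unfold_locales (auto simp: algebra_simps)
  show ?thesis
  proof unfold_locales
    show "bilinear_map (ext_scale scale) (*) (ext_form B)"
      unfolding bilinear_map_def linear_iff_module_hom
      by (auto intro!: module_hom.intro module_hom_axioms.intro E.module_axioms K
          simp: B_lin algebra_simps)
  next
    fix u :: "'k \<times> 'a \<times> 'k"
    assume *: "\<forall>v. ext_form B u v = 0"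
    obtain s x t where u: "u = (s, x, t)" by (cases u)
    \<comment> \<open>Pairing with d isolates the d^*-coefficient, pairing with d^* the
      d-coefficient up to sign, and pairing with \<open>ext_in y\<close> the component in the
      algebra.\<close>
    have "s = 0" using *[rule_format, of ext_d] by (simp add: u B_lin)
    moreover have "t = 0" using *[rule_format, of ext_dual] by (simp add: u B_lin)
    moreover have "x = 0"
    proof (intro nondegenerate_left allI)
      show "B x y = 0" for y using *[rule_format, of "ext_in y"] by (simp add: u)
    qed
    ultimately show "u = 0" by (simp add: u zero_prod_def)
  next
    fix u :: "'k \<times> 'a \<times> 'k"
    assume *: "\<forall>v. ext_form B v u = 0"
    obtain s x t where u: "u = (s, x, t)" by (cases u)
    have "s = 0" using *[rule_format, of ext_d] by (simp add: u B_lin)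
    moreover have "t = 0" using *[rule_format, of ext_dual] by (simp add: u B_lin)
    moreover have "x = 0"
    proof (intro nondegenerate_right allI)
      show "B y x = 0" for y using *[rule_format, of "ext_in y"] by (simp add: u)
    qed
    ultimately show "u = 0" by (simp add: u zero_prod_def)
  next
    fix u v :: "'k \<times> 'a \<times> 'k" and i j
    assume u: "u \<in> ext_grading G i" and v: "v \<in> ext_grading G j"
    obtain s x t s' y t' where uv: "u = (s, x, t)" "v = (s', y, t')"
      by (cases u; cases v)
    have x: "x \<in> G i" and y: "y \<in> G j"
      using u v by (auto simp: uv dest: ext_grading_component)
    \<comment> \<open>The pairing of d^* with d is antisymmetric, as supersymmetry demands of two
      odd elements.\<close>
    show "ext_form B u v = parity_sign (i * j) * ext_form B v u"
      using u v supersymmetric[OF x y]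
      by (cases i; cases j) (auto simp: uv ext_grading_def parity_sign_def algebra_simps)
    show "ext_form B u v = 0" if "i \<noteq> j"
      using u v even_form[OF x y that] that
      by (cases i; cases j) (auto simp: uv ext_grading_def)
  next
    fix u v w :: "'k \<times> 'a \<times> 'k"
    obtain s x t s' y t' s'' z t''
      where uvw: "u = (s, x, t)" "v = (s', y, t')" "w = (s'', z, t'')"
      by (cases u; cases v; cases w)
    \<comment> \<open>Compare coefficients of the scalars: the constant term is invariance of
      \<open>B\<close>, the \<open>t'\<close> terms agree by \<open>B_D_left\<close>, the
      \<open>t''\<close> terms by \<open>B_\<delta>_left\<close>, and the \<open>t * t'\<close>
      terms by symmetry of pairing with the even element \<open>a0\<close>.\<close>
    show "ext_form B (u \<odot> v) w = ext_form B u (v \<odot> w)"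
      by (simp add: uvw B_lin invariant B_\<delta>_left B_D_left B_a0_commute algebra_simps)
  qed
qed

end

theorem theorem34:
  fixes scale :: "'k::field \<Rightarrow> 'a::ab_group_add \<Rightarrow> 'a"
    and G :: "bit \<Rightarrow> 'a set"
    and mul :: "'a \<Rightarrow> 'a \<Rightarrow> 'a"
    and B :: "'a \<Rightarrow> 'a \<Rightarrow> 'k"
    and \<delta> D :: "'a \<Rightarrow> 'a"
    and a0 :: 'a
  assumes "quadratic_zinbiel_superalgebra scale G mul B"
    and "admissible_triple scale G mul 1 \<delta> D a0"
    and "range \<delta> \<subseteq> annihilator mul"
    and "\<delta> ` product_square scale mul = {0}"
    and "\<delta> \<circ> D = (\<lambda>_. 0)" and "D \<circ> \<delta> = (\<lambda>_. 0)"
    and "a0 \<in> annihilator mul \<inter> G 0"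
    and "B a0 a0 = 0"
    and "\<And>i j x y. x \<in> G i \<Longrightarrow> y \<in> G j \<Longrightarrow> B (\<delta> x) y = parity_sign (i + j) * B x (D y)"
  shows "symmetric_zinbiel_superalgebra (ext_scale scale) (ext_grading G) (ext_mul scale mul B \<delta> D a0)
    \<and> invariant_scalar_product (ext_scale scale) (ext_grading G) (ext_mul scale mul B \<delta> D a0) (ext_form B)"
proof -
  interpret admissible_triple scale G mul 1 \<delta> D a0 by fact
  interpret invariant_scalar_product scale G mul B
    using assms(1) by (simp add: quadratic_zinbiel_superalgebra_def)
  interpret odd_double_extension scale G mul \<delta> D a0 B
  proof unfold_locales
    show "\<delta> (mul x y) = 0" for x y
    proof -
      \<comment> \<open>A single product lies in the span of all products, on which
        \<open>\<delta>\<close> vanishes.\<close>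
      have "mul x y \<in> product_square scale mul"
        unfolding product_square_def by (rule span_base) blast
      then show ?thesis using assms(4) by blast
    qed
  qed (use assms(3,5,6,8,9) in \<open>auto simp: fun_eq_iff\<close>)
  show ?thesis
    using symmetric_zinbiel_ext invariant_scalar_product_ext by blast
qed

end
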